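(* Let $G$ be a finite group, let $p$ be a prime, and let $P$ be a Sylow $p$-subgroup of $G$. Then $|\mathbf{Z}(G)|$ divides $|\mathcal{S}_{p'}(G)|$. Furthermore, $$|\mathcal{S}_{p'}(G)|_p=|\mathbf{Z}(G)|_p$$ if and only if $[\mathbf{Z}(P),G]=1$.
   Context: $\mathbf{Z}(X)$ denotes the centre of a group $X$, and $[\mathbf{Z}(P),G]$ is the subgroup generated by all commutators $[z,g]$ with $z\in\mathbf{Z}(P)$, $g\in G$. For a positive integer $n$ and a prime $p$, $n_p$ denotes the largest power of $p$ dividing $n$. For a finite group $G$, $\mathcal{S}_{p'}(G)$ denotes the union of those conjugacy classes of $G$ whose cardinality is coprime to $p$, i.e. $\mathcal{S}_{p'}(G)=\{g\in G: p\nmid |G:\mathbf{C}_G(g)|\}$, where $\mathbf{C}_G(g)$ is the centralizer of $g$ in $G$. *)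

theory Defs
  imports "HOL-Algebra.Sylow" "HOL-Algebra.Generated_Groups" "HOL-Algebra.Group_Action"
begin

definition center :: "('a, 'b) monoid_scheme \<Rightarrow> 'a set" where
  "center G = {z \<in> carrier G. \<forall>g \<in> carrier G. z \<otimes>\<^bsub>G\<^esub> g = g \<otimes>\<^bsub>G\<^esub> z}"

definition centralizer :: "('a, 'b) monoid_scheme \<Rightarrow> 'a \<Rightarrow> 'a set" where
  "centralizer G g = {x \<in> carrier G. x \<otimes>\<^bsub>G\<^esub> g = g \<otimes>\<^bsub>G\<^esub> x}"

(* Commutators are taken as x y x^-1 y^-1, as in the library's derived_set, so that
   commutator_subgroup G H H = derived G H.  For subgroups H and K the convention
   x^-1 y^-1 x y yields the same set of commutators, because H and K are closed under
   inverses. *)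
definition commutator_subgroup :: "('a, 'b) monoid_scheme \<Rightarrow> 'a set \<Rightarrow> 'a set \<Rightarrow> 'a set" where
  "commutator_subgroup G H K =
     generate G (\<Union>x \<in> H. \<Union>y \<in> K. {x \<otimes>\<^bsub>G\<^esub> y \<otimes>\<^bsub>G\<^esub> inv\<^bsub>G\<^esub> x \<otimes>\<^bsub>G\<^esub> inv\<^bsub>G\<^esub> y})"

definition p_part :: "nat \<Rightarrow> nat \<Rightarrow> nat" where
  "p_part p n = p ^ multiplicity p n"

definition sylow_subgroup :: "nat \<Rightarrow> 'a set \<Rightarrow> ('a, 'b) monoid_scheme \<Rightarrow> bool" where
  "sylow_subgroup p P G \<longleftrightarrow> subgroup P G \<and> card P = p_part p (order G)"

(* The orbits of the action of G on itself in group.action_by_conjugation. *)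
definition conjugacy_classes :: "('a, 'b) monoid_scheme \<Rightarrow> 'a set set" where
  "conjugacy_classes G =
     orbits G (carrier G) (\<lambda>g. \<lambda>h \<in> carrier G. g \<otimes>\<^bsub>G\<^esub> h \<otimes>\<^bsub>G\<^esub> inv\<^bsub>G\<^esub> g)"

definition p'_class_union :: "nat \<Rightarrow> ('a, 'b) monoid_scheme \<Rightarrow> 'a set" where
  "p'_class_union p G = \<Union> {C \<in> conjugacy_classes G. coprime (card C) p}"

lemma (in group) p'_class_union_eq:
  assumes "finite (carrier G)" and "Factorial_Ring.prime p"
  shows "p'_class_union p G = {g \<in> carrier G. \<not> p dvd card (rcosets (centralizer G g))}"
proof -
  let ?\<phi> = "\<lambda>g. \<lambda>h \<in> carrier G. g \<otimes> h \<otimes> inv g"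
  interpret A: group_action G "carrier G" ?\<phi>
    by (rule action_by_conjugation)
  have stab: "stabilizer G ?\<phi> g = centralizer G g" if g: "g \<in> carrier G" for g
  proof -
    have "x \<otimes> g \<otimes> inv x = g \<longleftrightarrow> x \<otimes> g = g \<otimes> x" if "x \<in> carrier G" for x
      by (rule inv_solve_right') (use that g in simp_all)
    with g show ?thesis
      unfolding stabilizer_def centralizer_def by auto
  qed
  have orb: "card (orbit G ?\<phi> g) = card (rcosets (centralizer G g))" if g: "g \<in> carrier G" for g
  proof -
    have sub: "subgroup (centralizer G g) G"
      using A.stabilizer_subgroup[OF g] stab[OF g] by simp
    have "card (orbit G ?\<phi> g) * card (centralizer G g) =
          card (rcosets (centralizer G g)) * card (centralizer G g)"
      using A.orbit_stabilizer_theorem[OF g] lagrange[OF sub] stab[OF g] by simp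
    moreover have "card (centralizer G g) > 0"
      using subgroup.finite_imp_card_positive[OF sub assms(1)] .
    ultimately show ?thesis by simp
  qed
  have cop: "coprime n p \<longleftrightarrow> \<not> p dvd n" for n
  proof
    assume "coprime n p"
    then show "\<not> p dvd n"
      by (metis assms(2) coprime_common_divisor dvd_refl not_prime_unit)
  next
    assume "\<not> p dvd n"
    then show "coprime n p"
      by (metis assms(2) prime_imp_coprime coprime_commute)
  qed
  have eq: "orbit G ?\<phi> x = orbit G ?\<phi> g"
    if "g \<in> carrier G" "x \<in> carrier G" "g \<in> orbit G ?\<phi> x" for g x
  proof -
    have "orbit G ?\<phi> x \<in> orbits G (carrier G) ?\<phi>" "orbit G ?\<phi> g \<in> orbits G (carrier G) ?\<phi>"
      using that(1,2) by (auto simp only: orbits_def)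
    then have "orbit G ?\<phi> x = orbit G ?\<phi> g \<or> orbit G ?\<phi> x \<inter> orbit G ?\<phi> g = {}"
      by (rule A.disjoint_union)
    with that(3) A.orbit_refl[OF that(1)] show ?thesis by blast
  qed
  have "g \<in> p'_class_union p G \<longleftrightarrow> g \<in> carrier G \<and> coprime (card (orbit G ?\<phi> g)) p" for g
  proof
    assume "g \<in> p'_class_union p G"
    then obtain C where C: "C \<in> orbits G (carrier G) ?\<phi>" "coprime (card C) p" "g \<in> C"
      unfolding p'_class_union_def conjugacy_classes_def by blast
    have g: "g \<in> carrier G"
      using A.orbits_coverture C(1,3) by blast
    obtain x where "x \<in> carrier G" "C = orbit G ?\<phi> x"
      using C(1) unfolding orbits_def by blast
    with eq g C(3) have "C = orbit G ?\<phi> g" by blast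
    with g C(2) show "g \<in> carrier G \<and> coprime (card (orbit G ?\<phi> g)) p" by simp
  next
    assume g: "g \<in> carrier G \<and> coprime (card (orbit G ?\<phi> g)) p"
    then have "g \<in> orbit G ?\<phi> g" "orbit G ?\<phi> g \<in> orbits G (carrier G) ?\<phi>"
      using A.orbit_refl unfolding orbits_def by blast+
    with g show "g \<in> p'_class_union p G"
      unfolding p'_class_union_def conjugacy_classes_def by blast
  qed
  then have "p'_class_union p G = {g \<in> carrier G. coprime (card (orbit G ?\<phi> g)) p}"
    by blast
  also have "\<dots> = {g \<in> carrier G. \<not> p dvd card (rcosets (centralizer G g))}"
    by (intro Collect_cong conj_cong refl) (simp only: orb cop)
  finally show ?thesis .
qed

end

theory Submission
  imports Defs "HOL-Algebra.Multiplicative_Group"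
begin

text \<open>
  Write \<open>S\<close> for the union of the conjugacy classes of size prime to \<open>p\<close>, \<open>Z\<close> for the centre of
  \<open>G\<close> and \<open>C\<close> for the centralizer of the Sylow subgroup \<open>P\<close>. Every class that meets \<open>C\<close> has size
  prime to \<open>p\<close>, because the centralizers of the elements of \<open>C\<close> contain \<open>P\<close>; so
  \<open>Z \<subseteq> C \<subseteq> S\<close>. Everything rests on the congruence \<open>|S| \<equiv> |C|\<close> modulo \<open>p |Z|\<close>.

  The group \<open>P \<times> Z\<close> acts on \<open>S - C\<close> by \<open>(x, z) \<cdot> g = x g x\<inverse> z\<close>. A stabilizer consists of the
  pairs \<open>(x, z)\<close> with \<open>[x, g] = z\<inverse>\<close>, so its elements make \<open>[x, g]\<close> central. For \<open>g \<in> S\<close> this forces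
  \<open>[x, g] = 1\<close> (lemma \<open>central_commutator_trivial\<close>): on the subgroup of all \<open>y\<close> with \<open>[y, g]\<close>
  central, \<open>y \<mapsto> [y, g]\<close> is a homomorphism whose kernel is the centralizer of \<open>g\<close>, so its image
  has order dividing the class size of \<open>g\<close>, which is prime to \<open>p\<close>, whereas \<open>[x, g]\<close>
  has \<open>p\<close>-power order for \<open>x \<in> P\<close>. The stabilizer of \<open>g\<close> is therefore
  \<open>(P \<inter> C\<^sub>G(g)) \<times> 1\<close>, and the orbit of \<open>g\<close> has \<open>|P : P \<inter> C\<^sub>G(g)| |Z|\<close> elements. The index is a
  nontrivial power of \<open>p\<close> when \<open>g\<close> does not centralize \<open>P\<close>, so \<open>p |Z|\<close> divides the size of every
  orbit and hence \<open>|S - C|\<close> (lemma \<open>prime_times_card_center_dvd_card_diff\<close>).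

  Since \<open>|Z|\<close> divides \<open>|C|\<close>, it follows that \<open>|Z|\<close> divides \<open>|S|\<close> and that \<open>|S| / |Z|\<close> is
  prime to \<open>p\<close> exactly when \<open>|C : Z|\<close> is. As \<open>P \<inter> C\<close>, the centre of \<open>P\<close>, is a \<open>p\<close>-subgroup of \<open>C\<close>
  of index prime to \<open>p\<close>, this happens exactly when \<open>P \<inter> C \<subseteq> Z\<close>
  (lemma \<open>sylow_center_central_iff\<close>), which is the commutator condition.
\<close>

section \<open>Centralizers of subsets\<close>

text \<open>
  The centre, the centralizer of an element and the group \<open>C\<close> above are all instances of this set, so
  closure under the group operations has to be established only once.
\<close>

definition set_centralizer :: "('a, 'b) monoid_scheme \<Rightarrow> 'a set \<Rightarrow> 'a set" where
  "set_centralizer G A = {x \<in> carrier G. \<forall>a \<in> A. x \<otimes>\<^bsub>G\<^esub> a = a \<otimes>\<^bsub>G\<^esub> x}"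

lemma center_eq_set_centralizer: "center G = set_centralizer G (carrier G)"
  by (simp add: center_def set_centralizer_def)

lemma centralizer_eq_set_centralizer: "centralizer G g = set_centralizer G {g}"
  by (simp add: centralizer_def set_centralizer_def)

lemma center_restrict_carrier:
  assumes "P \<subseteq> carrier G"
  shows "center (G\<lparr>carrier := P\<rparr>) = P \<inter> set_centralizer G P"
  using assms by (auto simp: center_def set_centralizer_def)

lemma set_centralizer_commutes:
  "x \<in> set_centralizer G A \<Longrightarrow> a \<in> A \<Longrightarrow> x \<otimes>\<^bsub>G\<^esub> a = a \<otimes>\<^bsub>G\<^esub> x"
  by (simp add: set_centralizer_def)

lemma center_commutes:
  "z \<in> center G \<Longrightarrow> g \<in> carrier G \<Longrightarrow> z \<otimes>\<^bsub>G\<^esub> g = g \<otimes>\<^bsub>G\<^esub> z"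
  by (simp add: center_def)

lemma center_closed: "z \<in> center G \<Longrightarrow> z \<in> carrier G"
  by (simp add: center_def)

lemma (in group) commutes_conj:
  assumes "x \<in> carrier G" "g \<in> carrier G" "x \<otimes> g = g \<otimes> x"
  shows "x \<otimes> g \<otimes> inv x = g"
  using assms inv_solve_right'[of g "x \<otimes> g" x] by simp

lemma (in group) subgroup_set_centralizer:
  assumes A: "A \<subseteq> carrier G"
  shows "subgroup (set_centralizer G A) G"
proof (rule subgroupI)
  have "\<one> \<in> set_centralizer G A"
    using A by (auto simp: set_centralizer_def)
  then show "set_centralizer G A \<noteq> {}" by blast
  show "set_centralizer G A \<subseteq> carrier G"
    by (auto simp: set_centralizer_def)
next
  fix x assume x: "x \<in> set_centralizer G A"
  have "inv x \<otimes> a = a \<otimes> inv x" if "a \<in> A" for a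
  proof -
    have c: "x \<in> carrier G" "a \<in> carrier G" "x \<otimes> a = a \<otimes> x"
      using x that A by (auto simp: set_centralizer_def)
    then have "x \<otimes> a \<otimes> inv x = a" by (rule commutes_conj)
    with c(1,2) show ?thesis
      using inv_solve_left'[of "a \<otimes> inv x" x a] by (simp add: m_assoc)
  qed
  with x show "inv x \<in> set_centralizer G A"
    by (simp add: set_centralizer_def)
next
  fix x y assume xy: "x \<in> set_centralizer G A" "y \<in> set_centralizer G A"
  have "x \<otimes> y \<otimes> a = a \<otimes> (x \<otimes> y)" if "a \<in> A" for a
  proof -
    have c: "x \<in> carrier G" "y \<in> carrier G" "a \<in> carrier G" "x \<otimes> a = a \<otimes> x" "y \<otimes> a = a \<otimes> y"
      using xy that A by (auto simp: set_centralizer_def)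
    have "x \<otimes> y \<otimes> a = x \<otimes> a \<otimes> y"
      using c(1-3) by (simp add: c(5) m_assoc)
    also have "\<dots> = a \<otimes> (x \<otimes> y)"
      using c(1-3) by (simp only: c(4) m_assoc)
    finally show ?thesis .
  qed
  with xy show "x \<otimes> y \<in> set_centralizer G A"
    by (simp add: set_centralizer_def)
qed

lemma (in group) subgroup_center: "subgroup (center G) G"
  by (simp add: center_eq_set_centralizer subgroup_set_centralizer)

lemma (in group) subgroup_centralizer:
  "g \<in> carrier G \<Longrightarrow> subgroup (centralizer G g) G"
  by (simp add: centralizer_eq_set_centralizer subgroup_set_centralizer)

section \<open>Counting with homomorphisms and actions\<close>

lemma (in group) card_subgroup_dvd:
  assumes "subgroup H G" "subgroup K G" "H \<subseteq> K"
  shows "card H dvd card K"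
proof -
  have "subgroup H (G\<lparr>carrier := K\<rparr>)"
    using assms by (simp add: subgroup_incl)
  from group.lagrange[OF subgroup.subgroup_is_group[OF assms(2) group_axioms] this]
  have "card K = card (rcosets\<^bsub>G\<lparr>carrier := K\<rparr>\<^esub> H) * card H" by (simp add: order_def)
  then show ?thesis by simp
qed

lemma (in group) pow_card_subgroup:
  assumes "subgroup H G" "x \<in> H"
  shows "x [^] card H = \<one>"
  using group.pow_order_eq_1[OF subgroup.subgroup_is_group[OF assms(1) group_axioms], of x] assms(2)
  by (simp add: order_def flip: nat_pow_consistent)

lemma (in group) eq_one_if_coprime_pow:
  assumes "x \<in> carrier G" "x [^] (m::nat) = \<one>" "x [^] (n::nat) = \<one>" "coprime m n"
  shows "x = \<one>"
proof -
  have "ord x dvd m" "ord x dvd n"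
    using assms by (simp_all add: pow_eq_id)
  with assms(4) have "ord x = 1"
    by (metis coprime_common_divisor_nat)
  with assms(1) show ?thesis by (simp only: ord_eq_1)
qed

lemma (in group_hom) card_kernel_times_image:
  "card (kernel G H h) * card (h ` carrier G) = order G"
proof -
  interpret K: group_hom G "H\<lparr>carrier := h ` carrier G\<rparr>" h
    using img_is_subgroup
    by (simp add: group_hom_def group_hom_axioms_def hom_def subgroup.subgroup_is_group)
  have "kernel G (H\<lparr>carrier := h ` carrier G\<rparr>) h = kernel G H h"
    by (simp add: kernel_def)
  then have "bij_betw (\<lambda>X. the_elem (h ` X)) (rcosets (kernel G H h)) (h ` carrier G)"
    using K.FactGroup_iso_set by (simp add: iso_def FactGroup_def)
  then have "card (rcosets (kernel G H h)) = card (h ` carrier G)"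
    by (rule bij_betw_same_card)
  then show ?thesis
    using G.lagrange[OF subgroup_kernel] by (simp add: mult.commute)
qed

text \<open>
  Bijectivity of each \<open>f g\<close> is automatic: \<open>f (inv g)\<close> is its inverse on \<open>E\<close>.
\<close>

lemma (in group) group_actionI:
  assumes closed: "\<And>g x. g \<in> carrier G \<Longrightarrow> x \<in> E \<Longrightarrow> f g x \<in> E"
    and one: "\<And>x. x \<in> E \<Longrightarrow> f \<one> x = x"
    and mult: "\<And>g h x. g \<in> carrier G \<Longrightarrow> h \<in> carrier G \<Longrightarrow> x \<in> E \<Longrightarrow> f (g \<otimes> h) x = f g (f h x)"
  shows "group_action G E (\<lambda>g. \<lambda>x \<in> E. f g x)"
proof -
  have inv: "f g (f (inv g) x) = x" "f (inv g) (f g x) = x" if "g \<in> carrier G" "x \<in> E" for g x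
    using that by (simp_all flip: mult add: one)
  have bij: "(\<lambda>x \<in> E. f g x) \<in> Bij E" if g: "g \<in> carrier G" for g
  proof -
    have "bij_betw (f g) E E"
      by (rule bij_betw_byWitness[where f' = "f (inv g)"]) (use g inv closed in auto)
    then show ?thesis by (simp add: Bij_def bij_betw_restrict_eq)
  qed
  have "(\<lambda>x \<in> E. f (g \<otimes> h) x) = compose E (\<lambda>x \<in> E. f g x) (\<lambda>x \<in> E. f h x)"
    if "g \<in> carrier G" "h \<in> carrier G" for g h
    using that closed mult by (auto simp: compose_def fun_eq_iff)
  then have "(\<lambda>g. \<lambda>x \<in> E. f g x) \<in> hom G (BijGroup E)"
    using bij by (auto simp: hom_def BijGroup_def)
  then show ?thesis
    by (simp add: group_action_def group_hom_def group_hom_axioms_def group_BijGroup group_axioms)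
qed

lemma (in group_action) dvd_card_if_dvd_orbits:
  assumes fin: "finite E"
    and orb: "\<And>x. x \<in> E \<Longrightarrow> d dvd card (orbit G \<phi> x)"
  shows "d dvd card E"
proof -
  have "card E = (\<Sum>X\<in>orbits G E \<phi>. card X)"
    using disjoint_sum[OF fin, of "\<lambda>_. 1 :: nat"] by simp
  with orb show ?thesis
    by (auto simp: orbits_def intro!: dvd_sum)
qed

section \<open>Classes of size prime to \<open>p\<close>\<close>

lemma (in group) mult_central_right:
  assumes "g \<in> carrier G" "z \<in> center G" "h \<in> carrier G"
  shows "g \<otimes> z \<otimes> h = g \<otimes> h \<otimes> z"
  using assms by (simp only: m_assoc center_closed center_commutes[OF assms(2,3)])

text \<open>
  The order of the central element \<open>z = [x, g]\<close> divides two coprime numbers. It divides the order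
  of \<open>P\<close>, as a homomorphic image of \<open>x\<close>, and it divides the size of the class of \<open>g\<close>, because the
  central elements of the form \<open>[y, g]\<close> form a group isomorphic to the quotient of a subgroup of \<open>G\<close>
  by the centralizer of \<open>g\<close>.
\<close>

lemma (in group) central_commutator_trivial:
  assumes fin: "finite (carrier G)" and p: "Factorial_Ring.prime p"
    and P: "subgroup P G" "card P = p ^ n"
    and g: "g \<in> p'_class_union p G" and x: "x \<in> P"
    and z: "z \<in> center G" "x \<otimes> g = z \<otimes> g \<otimes> x"
  shows "z = \<one>"
proof -
  have gc: "g \<in> carrier G" and idx: "\<not> p dvd card (rcosets (centralizer G g))"
    using g p'_class_union_eq[OF fin p] by auto
  note Z = center_closed
  define c where "c y = y \<otimes> g \<otimes> inv y \<otimes> inv g" for y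
  define N where "N = {y \<in> carrier G. c y \<in> center G}"
  have c_iff: "c y = a \<longleftrightarrow> y \<otimes> g = a \<otimes> g \<otimes> y" if "y \<in> carrier G" "a \<in> carrier G" for y a
  proof -
    have "c y = a \<longleftrightarrow> y \<otimes> g \<otimes> inv y = a \<otimes> g"
      unfolding c_def using that gc inv_solve_right' by simp
    also have "\<dots> \<longleftrightarrow> y \<otimes> g = a \<otimes> g \<otimes> y"
      using that gc inv_solve_right' by simp
    finally show ?thesis .
  qed
  have cc: "c y \<in> carrier G" if "y \<in> carrier G" for y
    using that gc by (simp add: c_def)
  have cN: "y \<otimes> g = c y \<otimes> g \<otimes> y" if "y \<in> carrier G" for y
    using c_iff[OF that cc[OF that]] by simp
  \<comment> \<open>In general \<open>[u v, g] = u [v, g] u\<inverse> [u, g]\<close>; centrality of \<open>[v, g]\<close> removes the conjugation.\<close>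
  have mult: "c (u \<otimes> v) = c u \<otimes> c v" if uv: "u \<in> carrier G" "v \<in> N" for u v
  proof -
    have v: "v \<in> carrier G" "c v \<in> center G" using uv by (auto simp: N_def)
    have "u \<otimes> v \<otimes> g = u \<otimes> (c v \<otimes> g \<otimes> v)"
      using uv v gc cN[of v] by (simp add: m_assoc)
    also have "\<dots> = u \<otimes> c v \<otimes> (g \<otimes> v)"
      using uv v gc cc by (simp add: m_assoc)
    also have "u \<otimes> c v = c v \<otimes> u"
      using center_commutes[OF v(2) uv(1)] by simp
    also have "c v \<otimes> u \<otimes> (g \<otimes> v) = c v \<otimes> (u \<otimes> g) \<otimes> v"
      using uv v gc cc by (simp add: m_assoc)
    also have "\<dots> = c v \<otimes> c u \<otimes> g \<otimes> (u \<otimes> v)"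
      using uv v gc cc cN[of u] by (simp add: m_assoc)
    also have "c v \<otimes> c u = c u \<otimes> c v"
      using v(2) cc[OF uv(1)] by (rule center_commutes)
    finally show ?thesis
      using c_iff[of "u \<otimes> v"] uv v cc by simp
  qed
  have inv_c: "c (inv u) = inv (c u)" if u: "u \<in> N" for u
  proof -
    have u': "u \<in> carrier G" using u by (simp add: N_def)
    have "c (inv u) \<otimes> c u = c (inv u \<otimes> u)"
      using mult[of "inv u" u] u u' by simp
    also have "\<dots> = \<one>" using u' gc by (simp add: c_def)
    finally show ?thesis
      using cc u' by (metis inv_closed inv_equality)
  qed
  have N: "subgroup N G"
  proof (rule subgroupI)
    have "c \<one> = \<one>" using gc by (simp add: c_def)
    then show "N \<noteq> {}"
      using subgroup.one_closed[OF subgroup_center] by (auto simp: N_def)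
  qed (use mult inv_c subgroup.m_inv_closed[OF subgroup_center]
      subgroup.m_closed[OF subgroup_center] in \<open>auto simp: N_def\<close>)
  interpret h: group_hom "G\<lparr>carrier := N\<rparr>" G c
    using N mult cc
    by (auto simp: group_hom_def group_hom_axioms_def hom_def N_def group_axioms
        subgroup.subgroup_is_group)
  have ker: "kernel (G\<lparr>carrier := N\<rparr>) G c = centralizer G g"
  proof -
    have "y \<in> carrier G \<and> c y \<in> center G \<and> c y = \<one> \<longleftrightarrow> y \<in> carrier G \<and> y \<otimes> g = g \<otimes> y" for y
      using subgroup.one_closed[OF subgroup_center] gc c_iff[of y \<one>] by auto
    then show ?thesis by (simp add: kernel_def centralizer_def N_def conj_assoc)
  qed
  have xc: "x \<in> carrier G" by (rule subgroup.mem_carrier[OF P(1) x])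
  have cz: "c x = z"
    using c_iff[OF xc Z[OF z(1)]] z(2) by simp
  have xN: "x \<in> N"
    using cz z(1) xc by (simp add: N_def)
  have "card (centralizer G g) * card (c ` N) = card N"
    using h.card_kernel_times_image by (simp add: ker order_def)
  moreover have "card N dvd order G"
    using card_subgroup_dvd[OF N subgroup_self subgroup.subset[OF N]] by (simp only: order_def)
  moreover have "card (rcosets (centralizer G g)) * card (centralizer G g) = order G"
    by (rule lagrange[OF subgroup_centralizer[OF gc]])
  moreover have "card (centralizer G g) > 0"
    using subgroup.finite_imp_card_positive[OF subgroup_centralizer[OF gc] fin] .
  ultimately have "card (c ` N) dvd card (rcosets (centralizer G g))"
    by (metis dvd_times_right_cancel_iff mult.commute less_not_refl2)
  with idx have "\<not> p dvd card (c ` N)" by (meson dvd_trans)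
  then have "coprime (card (c ` N)) (card P)"
    using p P(2) by (metis coprime_commute coprime_power_left_iff prime_imp_coprime)
  moreover have "z [^] card (c ` N) = \<one>"
    using pow_card_subgroup[of "c ` N" z] h.img_is_subgroup xN cz by auto
  moreover have "z [^] card P = \<one>"
  proof -
    have "z [^] card P = c (x [^] card P)"
      using h.hom_nat_pow[of x "card P"] xN cz by (simp flip: nat_pow_consistent)
    also have "\<dots> = \<one>"
      using pow_card_subgroup[OF P(1) x] gc by (simp add: c_def)
    finally show ?thesis .
  qed
  ultimately show ?thesis
    using eq_one_if_coprime_pow[OF Z[OF z(1)]] by blast
qed

lemma (in group) p'_class_union_conj:
  assumes fin: "finite (carrier G)" and p: "Factorial_Ring.prime p"
    and g: "g \<in> p'_class_union p G" and x: "x \<in> carrier G"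
  shows "x \<otimes> g \<otimes> inv x \<in> p'_class_union p G"
proof -
  let ?\<phi> = "\<lambda>g. \<lambda>h \<in> carrier G. g \<otimes> h \<otimes> inv g"
  interpret A: group_action G "carrier G" ?\<phi>
    by (rule action_by_conjugation)
  obtain C where C: "C \<in> conjugacy_classes G" "coprime (card C) p" "g \<in> C"
    using g unfolding p'_class_union_def by blast
  then obtain a where a: "a \<in> carrier G" "C = orbit G ?\<phi> a"
    unfolding conjugacy_classes_def orbits_def by blast
  have gc: "g \<in> carrier G"
    using g p'_class_union_eq[OF fin p] by auto
  have "x \<otimes> g \<otimes> inv x \<in> orbit G ?\<phi> g"
    using x gc by (auto simp: orbit_def)
  then have "x \<otimes> g \<otimes> inv x \<in> C"
    using A.orbit_trans[OF a(1) gc, of "x \<otimes> g \<otimes> inv x"] a(2) C(3) x gc by simp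
  with C show ?thesis unfolding p'_class_union_def by blast
qed

lemma (in group) centralizer_mult_central:
  assumes "g \<in> carrier G" "z \<in> center G"
  shows "centralizer G (g \<otimes> z) = centralizer G g"
proof -
  have z: "z \<in> carrier G" using assms(2) by (rule center_closed)
  have "x \<otimes> (g \<otimes> z) = g \<otimes> z \<otimes> x \<longleftrightarrow> x \<otimes> g = g \<otimes> x" if "x \<in> carrier G" for x
    unfolding mult_central_right[OF assms that]
    using assms(1) that z by (simp flip: m_assoc)
  then show ?thesis by (auto simp: centralizer_def)
qed

lemma (in group) p'_class_union_mult_central:
  assumes fin: "finite (carrier G)" and p: "Factorial_Ring.prime p"
    and g: "g \<in> p'_class_union p G" and z: "z \<in> center G"
  shows "g \<otimes> z \<in> p'_class_union p G"
  using g z center_closed[OF z]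
  by (simp add: p'_class_union_eq[OF fin p] centralizer_mult_central)

text \<open>
  The set is invariant under conjugation by \<open>P\<close> and multiplication by the centre, and these two
  actions interfere nowhere on it: by the triviality of central commutators, a conjugate
  of \<open>g\<close> under \<open>P\<close> lies in the coset of \<open>g\<close> modulo the centre only if it is \<open>g\<close> itself. So every orbit
  of \<open>P \<times> Z\<close> has the size of a \<open>P\<close>-orbit, a multiple of \<open>p\<close>, times the size of \<open>Z\<close>.
\<close>

lemma (in group) prime_times_card_center_dvd_card_diff:
  assumes fin: "finite (carrier G)" and p: "Factorial_Ring.prime p"
    and P: "subgroup P G" "card P = p ^ n"
  shows "p * card (center G) dvd card (p'_class_union p G - set_centralizer G P)"
proof -
  define Z where "Z = center G"
  define E where "E = p'_class_union p G - set_centralizer G P"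
  define f where "f = (\<lambda>(x, z) g. x \<otimes> g \<otimes> inv x \<otimes> z)"
  let ?A = "(G\<lparr>carrier := P\<rparr>) \<times>\<times> (G\<lparr>carrier := Z\<rparr>)"
  have Z: "subgroup Z G" by (simp add: Z_def subgroup_center)
  note Zc = subgroup.mem_carrier[OF Z] and Pc = subgroup.mem_carrier[OF P(1)]
  have Ec: "E \<subseteq> carrier G"
    using p'_class_union_eq[OF fin p] by (auto simp: E_def)
  have C: "subgroup (set_centralizer G P) G"
    using P(1) by (intro subgroup_set_centralizer subgroup.subset)
  have ZC: "Z \<subseteq> set_centralizer G P"
    using Pc by (auto simp: Z_def center_def set_centralizer_def)
  interpret A: group ?A
    by (intro DirProd_group subgroup.subgroup_is_group P(1) Z group_axioms)
  have f_closed: "f a g \<in> E" if a: "a \<in> carrier ?A" and g: "g \<in> E" for a g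
  proof -
    obtain x z where xz: "a = (x, z)" "x \<in> P" "z \<in> Z" using a by auto
    have gc: "g \<in> carrier G" using g Ec by blast
    let ?h = "x \<otimes> g \<otimes> inv x \<otimes> z"
    have "g \<in> p'_class_union p G" "z \<in> center G"
      using g xz by (simp_all add: E_def Z_def)
    then have S: "?h \<in> p'_class_union p G"
      using p'_class_union_mult_central[OF fin p p'_class_union_conj[OF fin p _ Pc[OF xz(2)]]]
      by blast
    \<comment> \<open>If the image centralizes \<open>P\<close>, then so does \<open>x g x\<inverse>\<close>; commuting with \<open>x\<close>, it equals \<open>g\<close>.\<close>
    have "?h \<notin> set_centralizer G P"
    proof
      assume "?h \<in> set_centralizer G P"
      then have "?h \<otimes> inv z \<in> set_centralizer G P"
        by (rule subgroup.m_closed[OF C _ subgroup.m_inv_closed[OF C subsetD[OF ZC xz(3)]]])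
      then have t: "x \<otimes> g \<otimes> inv x \<in> set_centralizer G P"
        using xz gc Pc Zc by (simp add: m_assoc)
      then have "x \<otimes> g \<otimes> inv x \<otimes> x = x \<otimes> (x \<otimes> g \<otimes> inv x)"
        using xz(2) by (simp add: set_centralizer_def)
      then have "g = x \<otimes> g \<otimes> inv x"
        using xz gc Pc by (simp add: m_assoc)
      with t g show False by (simp add: E_def)
    qed
    with S show ?thesis by (simp add: E_def f_def xz(1))
  qed
  have act: "group_action ?A E (\<lambda>a. \<lambda>g \<in> E. f a g)"
  proof (rule A.group_actionI)
    show "f a g \<in> E" if "a \<in> carrier ?A" "g \<in> E" for a g
      by (rule f_closed) (use that in auto)
    show "f \<one>\<^bsub>?A\<^esub> g = g" if "g \<in> E" for g
      using that Ec by (auto simp: f_def)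
    show "f (a \<otimes>\<^bsub>?A\<^esub> b) g = f a (f b g)"
      if a: "a \<in> carrier ?A" and b: "b \<in> carrier ?A" and g: "g \<in> E" for a b g
    proof -
      obtain x z y w where ab: "a = (x, z)" "x \<in> P" "z \<in> Z" "b = (y, w)" "y \<in> P" "w \<in> Z"
        using a b by auto
      have cs: "x \<in> carrier G" "y \<in> carrier G" "z \<in> carrier G" "w \<in> carrier G" "g \<in> carrier G"
        using ab g Ec Pc Zc by auto
      have "w \<otimes> (inv x \<otimes> z) = inv x \<otimes> (z \<otimes> w)"
        using ab cs center_commutes[of w G "inv x \<otimes> z"] by (simp add: Z_def m_assoc)
      then show ?thesis
        using cs by (simp add: f_def ab m_assoc inv_mult_group)
    qed
  qed
  interpret act: group_action ?A E "\<lambda>a. \<lambda>g \<in> E. f a g" by (rule act)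
  have "p * card Z dvd card E"
  proof (rule act.dvd_card_if_dvd_orbits)
    show "finite E" using Ec fin finite_subset by blast
  next
    fix g assume g: "g \<in> E"
    have gc: "g \<in> carrier G" and gS: "g \<in> p'_class_union p G" and gC: "g \<notin> set_centralizer G P"
      using g Ec by (auto simp: E_def)
    let ?D = "P \<inter> centralizer G g"
    have "f (x, z) g = g \<longleftrightarrow> x \<in> centralizer G g \<and> z = \<one>" if xz: "x \<in> P" "z \<in> Z" for x z
    proof
      assume fx: "f (x, z) g = g"
      have cs: "x \<in> carrier G" "z \<in> carrier G" using xz Pc Zc by auto
      have "x \<otimes> g \<otimes> inv x = g \<otimes> inv z"
        using fx cs gc inv_solve_right[of g "x \<otimes> g \<otimes> inv x" z] by (auto simp: f_def inv_solve_right)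
      then have "x \<otimes> g = g \<otimes> inv z \<otimes> x"
        using cs gc by (metis inv_closed inv_solve_right' m_closed)
      moreover have iz: "inv z \<in> center G" "inv z \<in> carrier G"
        using xz(2) Z cs subgroup.m_inv_closed unfolding Z_def by auto
      ultimately have eq: "x \<otimes> g = inv z \<otimes> g \<otimes> x"
        using gc center_commutes[of "inv z" G g] by simp
      then have "inv z = \<one>"
        using central_commutator_trivial[OF fin p P gS xz(1) iz(1)] by blast
      with eq cs gc show "x \<in> centralizer G g \<and> z = \<one>"
        by (simp add: centralizer_def)
    next
      assume xg: "x \<in> centralizer G g \<and> z = \<one>"
      then have "x \<otimes> g \<otimes> inv x = g"
        using gc by (intro commutes_conj) (auto simp: centralizer_def)
      with xg gc show "f (x, z) g = g"
        by (simp add: f_def)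
    qed
    then have "stabilizer ?A (\<lambda>a. \<lambda>g \<in> E. f a g) g = ?D \<times> {\<one>}"
      using g subgroup.one_closed[OF Z] by (auto simp: stabilizer_def)
    then have os: "card (orbit ?A (\<lambda>a. \<lambda>g \<in> E. f a g) g) * card ?D = card P * card Z"
      using act.orbit_stabilizer_theorem[OF g] by (simp add: order_def card_cartesian_product)
    have D: "subgroup ?D G"
      using P(1) subgroup_centralizer[OF gc] by (simp add: subgroups_Inter_pair)
    obtain j where j: "card P = card ?D * j"
      using card_subgroup_dvd[OF D P(1)] by auto
    have "j \<noteq> 1"
    proof
      assume "j = 1"
      then have "?D = P"
        using j by (intro card_subset_eq)
          (auto intro: finite_subset[OF subgroup.subset[OF P(1)] fin])
      then have "g \<otimes> a = a \<otimes> g" if "a \<in> P" for a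
        using that unfolding centralizer_def by force
      with gC gc show False by (simp add: set_centralizer_def)
    qed
    moreover have "j dvd p ^ n" using j P(2) by (metis dvd_triv_right)
    ultimately have "p dvd j"
      using divides_primepow_nat[OF p, of j n] by (auto simp: le_Suc_eq intro: dvd_power)
    moreover have "card ?D > 0"
      using subgroup.finite_imp_card_positive[OF D fin] .
    then have "card (orbit ?A (\<lambda>a. \<lambda>g \<in> E. f a g) g) = j * card Z"
      using os j by (simp add: mult.assoc mult.left_commute)
    ultimately show "p * card Z dvd card (orbit ?A (\<lambda>a. \<lambda>g \<in> E. f a g) g)"
      by (simp add: mult_dvd_mono)
  qed
  then show ?thesis by (simp add: Z_def E_def)
qed

section \<open>The centralizer of a Sylow subgroup\<close>

text \<open>
  Elements of \<open>P\<close> commute with those of its centralizer, so multiplication is a homomorphism from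
  their direct product to \<open>G\<close>. Its kernel is a copy of the intersection and its image is a subgroup
  of \<open>G\<close>. For a Sylow subgroup this says that the index of its centre in its centralizer is prime to
  \<open>p\<close>.
\<close>

lemma (in group) card_times_card_set_centralizer_dvd:
  assumes P: "subgroup P G"
  shows "card P * card (set_centralizer G P) dvd card (P \<inter> set_centralizer G P) * order G"
proof -
  define C where "C = set_centralizer G P"
  have C: "subgroup C G"
    unfolding C_def using P by (intro subgroup_set_centralizer subgroup.subset)
  note cs = subgroup.mem_carrier[OF P] subgroup.mem_carrier[OF C]
  let ?A = "(G\<lparr>carrier := P\<rparr>) \<times>\<times> (G\<lparr>carrier := C\<rparr>)"
  let ?m = "\<lambda>(x, c). x \<otimes> c"
  have A: "group ?A"
    by (intro DirProd_group subgroup.subgroup_is_group P C group_axioms)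
  have "x \<otimes> y \<otimes> (c \<otimes> d) = x \<otimes> c \<otimes> (y \<otimes> d)" if "x \<in> P" "y \<in> P" "c \<in> C" "d \<in> C" for x y c d
  proof -
    have "c \<otimes> y = y \<otimes> c"
      using set_centralizer_commutes that(2,3) unfolding C_def by fast
    then have "y \<otimes> (c \<otimes> d) = c \<otimes> (y \<otimes> d)"
      using that cs by (simp flip: m_assoc)
    with that cs show ?thesis by (simp add: m_assoc)
  qed
  then interpret m: group_hom ?A G ?m
    using A cs by (auto simp: group_hom_def group_hom_axioms_def hom_def group_axioms)
  have "bij_betw fst (kernel ?A G ?m) (P \<inter> C)"
  proof (rule bij_betw_byWitness[where f' = "\<lambda>x. (x, inv x)"])
    have inv_eq: "c = inv x" if "x \<in> P" "c \<in> C" "x \<otimes> c = \<one>" for x c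
      using that cs by (metis inv_equality inv_inv inv_closed)
    then show "\<forall>a\<in>kernel ?A G ?m. (fst a, inv (fst a)) = a"
      by (auto simp: kernel_def)
    have "x \<in> C" if "x \<in> P" "c \<in> C" "x \<otimes> c = \<one>" for x c
      using inv_eq[OF that] that cs subgroup.m_inv_closed[OF C, of c] by simp
    then show "fst ` kernel ?A G ?m \<subseteq> P \<inter> C"
      by (auto simp: kernel_def)
    show "(\<lambda>x. (x, inv x)) ` (P \<inter> C) \<subseteq> kernel ?A G ?m"
      using cs subgroup.m_inv_closed[OF C] by (auto simp: kernel_def)
  qed simp
  then have "card (P \<inter> C) * card (?m ` carrier ?A) = card P * card C"
    using m.card_kernel_times_image bij_betw_same_card by (fastforce simp: order_def card_cartesian_product)
  moreover have "card (?m ` carrier ?A) dvd order G"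
    using card_subgroup_dvd[OF m.img_is_subgroup subgroup_self] subgroup.subset[OF m.img_is_subgroup]
    by (simp add: order_def)
  ultimately show ?thesis
    by (metis C_def dvd_refl mult_dvd_mono)
qed

lemma (in group) prime_times_card_sylow_not_dvd:
  assumes fin: "finite (carrier G)" and p: "Factorial_Ring.prime p" and P: "sylow_subgroup p P G"
  shows "\<not> p * card P dvd order G"
proof
  assume dvd: "p * card P dvd order G"
  have "order G > 0" using fin by (simp add: order_gt_0_iff_finite)
  moreover have "p ^ Suc (multiplicity p (order G)) dvd order G"
    using dvd P by (simp add: sylow_subgroup_def p_part_def)
  ultimately show False
    using power_dvd_iff_le_multiplicity[of "order G" p "Suc (multiplicity p (order G))"]
      prime_gt_1_nat[OF p] by simp
qed

lemma (in group) set_centralizer_sylow_subset: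
  assumes fin: "finite (carrier G)" and p: "Factorial_Ring.prime p" and P: "sylow_subgroup p P G"
  shows "set_centralizer G P \<subseteq> p'_class_union p G"
proof
  fix g assume g: "g \<in> set_centralizer G P"
  have gc: "g \<in> carrier G" using g by (simp add: set_centralizer_def)
  have PG: "subgroup P G" using P by (simp add: sylow_subgroup_def)
  have "P \<subseteq> centralizer G g"
    using g subgroup.mem_carrier[OF PG] by (auto simp: centralizer_def set_centralizer_def)
  then have "card P dvd card (centralizer G g)"
    using card_subgroup_dvd[OF PG subgroup_centralizer[OF gc]] by simp
  then have "p * card P dvd order G" if "p dvd card (rcosets (centralizer G g))"
    using mult_dvd_mono[OF that, of "card P" "card (centralizer G g)"]
      lagrange[OF subgroup_centralizer[OF gc]] by simp
  then show "g \<in> p'_class_union p G"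
    using prime_times_card_sylow_not_dvd[OF fin p P] gc by (auto simp: p'_class_union_eq[OF fin p])
qed

lemma (in group) commutator_subgroup_carrier_trivial_iff:
  assumes "H \<subseteq> carrier G"
  shows "commutator_subgroup G H (carrier G) = {\<one>} \<longleftrightarrow> H \<subseteq> center G"
proof -
  let ?K = "\<Union>x \<in> H. \<Union>y \<in> carrier G. {x \<otimes> y \<otimes> inv x \<otimes> inv y}"
  have comm: "x \<otimes> y \<otimes> inv x \<otimes> inv y = \<one> \<longleftrightarrow> x \<otimes> y = y \<otimes> x" if "x \<in> H" "y \<in> carrier G" for x y
  proof -
    have c: "x \<in> carrier G" "y \<in> carrier G" using that assms by auto
    then show ?thesis
      using inv_solve_right'[of \<one> "x \<otimes> y \<otimes> inv x" y] inv_solve_right'[of y "x \<otimes> y" x] by simp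
  qed
  have "generate G ?K = {\<one>} \<longleftrightarrow> ?K \<subseteq> {\<one>}"
  proof
    show "?K \<subseteq> {\<one>}" if "generate G ?K = {\<one>}"
      using that generate.incl[of _ ?K G] by blast
    show "generate G ?K = {\<one>}" if "?K \<subseteq> {\<one>}"
      using that mono_generate[OF that] generate_one generate.one by blast
  qed
  also have "\<dots> \<longleftrightarrow> H \<subseteq> center G"
  proof -
    have "?K \<subseteq> {\<one>} \<longleftrightarrow> (\<forall>x \<in> H. \<forall>y \<in> carrier G. x \<otimes> y \<otimes> inv x \<otimes> inv y = \<one>)"
      by blast
    also have "\<dots> \<longleftrightarrow> (\<forall>x \<in> H. \<forall>y \<in> carrier G. x \<otimes> y = y \<otimes> x)"
      by (intro ball_cong refl comm)
    also have "\<dots> \<longleftrightarrow> H \<subseteq> center G"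
      using assms unfolding center_def by blast
    finally show ?thesis .
  qed
  finally show ?thesis by (simp add: commutator_subgroup_def)
qed

text \<open>
  Here \<open>k\<close> is the order of the quotient of the centralizer by the centre of \<open>G\<close>. If \<open>k\<close> is prime to
  \<open>p\<close>, the \<open>p\<close>-elements of the centralizer that lie in \<open>P\<close> vanish in the quotient. If instead the
  centre of \<open>P\<close> is contained in that of \<open>G\<close>, then \<open>k\<close> divides the index of the centre of \<open>P\<close> in the
  centralizer, which is prime to \<open>p\<close>.
\<close>

lemma (in group) sylow_center_central_iff:
  assumes fin: "finite (carrier G)" and p: "Factorial_Ring.prime p" and P: "sylow_subgroup p P G"
    and k: "card (set_centralizer G P) = card (center G) * k"
  shows "\<not> p dvd k \<longleftrightarrow> P \<inter> set_centralizer G P \<subseteq> center G"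
proof
  have PG: "subgroup P G" and cP: "card P = p ^ multiplicity p (order G)"
    using P by (simp_all add: sylow_subgroup_def p_part_def)
  note Pc = subgroup.mem_carrier[OF PG]
  define C where "C = set_centralizer G P"
  define Z where "Z = center G"
  have C: "subgroup C G"
    unfolding C_def using PG by (intro subgroup_set_centralizer subgroup.subset)
  have Z: "subgroup Z G" by (simp add: Z_def subgroup_center)
  have ZC: "Z \<subseteq> C" using Pc by (auto simp: Z_def C_def center_def set_centralizer_def)
  have fC: "card Z > 0" "card (P \<inter> C) > 0"
    using fin C Z subgroups_Inter_pair[OF PG C] subgroup.finite_imp_card_positive by blast+
  show "P \<inter> set_centralizer G P \<subseteq> center G" if pk: "\<not> p dvd k"
  proof
    fix x assume x: "x \<in> P \<inter> set_centralizer G P"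
    then have xC: "x \<in> C" and xP: "x \<in> P" by (auto simp: C_def)
    let ?K = "G\<lparr>carrier := C\<rparr>"
    have K: "group ?K" by (rule subgroup.subgroup_is_group[OF C group_axioms])
    have ZK: "subgroup Z ?K" by (rule subgroup_incl[OF Z C ZC])
    interpret N: normal Z ?K
    proof (rule group.normal_invI[OF K ZK])
      fix y z assume y: "y \<in> carrier ?K" and z: "z \<in> Z"
      have "y \<otimes> z \<otimes> inv y = z"
        using y z subgroup.mem_carrier[OF C] subgroup.mem_carrier[OF Z]
        by (intro commutes_conj) (auto simp: Z_def center_commutes)
      then show "y \<otimes>\<^bsub>?K\<^esub> z \<otimes>\<^bsub>?K\<^esub> inv\<^bsub>?K\<^esub> y \<in> Z"
        using y z C by (simp add: m_inv_consistent)
    qed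
    interpret Q: group "?K Mod Z" by (rule N.factorgroup_is_group)
    interpret q: group_hom ?K "?K Mod Z" "\<lambda>a. Z #>\<^bsub>?K\<^esub> a"
      using N.r_coset_hom_Mod by (simp add: group_hom_def group_hom_axioms_def K Q.group_axioms)
    let ?x = "Z #>\<^bsub>?K\<^esub> x"
    have xQ: "?x \<in> carrier (?K Mod Z)" using xC q.hom_closed[of x] by simp
    have "order (?K Mod Z) * card Z = card C"
      using group.lagrange[OF K ZK] by (simp add: order_def FactGroup_def)
    then have "order (?K Mod Z) = k"
      using k fC by (simp add: C_def Z_def mult.commute)
    then have "?x [^]\<^bsub>?K Mod Z\<^esub> k = \<one>\<^bsub>?K Mod Z\<^esub>"
      using Q.pow_order_eq_1[OF xQ] by simp
    moreover have "?x [^]\<^bsub>?K Mod Z\<^esub> card P = \<one>\<^bsub>?K Mod Z\<^esub>"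
    proof -
      have "x [^]\<^bsub>?K\<^esub> card P = \<one>\<^bsub>?K\<^esub>"
        using pow_card_subgroup[OF PG xP] by (simp flip: nat_pow_consistent)
      then show ?thesis
        using q.hom_nat_pow[of x "card P"] xC q.hom_one by simp
    qed
    moreover have "coprime k (card P)"
      using p pk cP by (metis coprime_commute coprime_power_left_iff prime_imp_coprime)
    ultimately have "?x = \<one>\<^bsub>?K Mod Z\<^esub>"
      using Q.eq_one_if_coprime_pow[OF xQ] by blast
    then have "?x = Z" by simp
    then show "x \<in> center G"
      using group.rcos_self[OF K, of x Z] xC ZK by (simp add: Z_def)
  qed
  show "\<not> p dvd k" if sub: "P \<inter> set_centralizer G P \<subseteq> center G"
  proof
    assume "p dvd k"
    have "card (P \<inter> C) dvd card Z"
      using card_subgroup_dvd[OF subgroups_Inter_pair[OF PG C] Z] sub by (simp add: C_def Z_def)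
    then have "card (P \<inter> C) * p dvd card C"
      using k \<open>p dvd k\<close> by (simp add: C_def Z_def mult_dvd_mono)
    then have "card P * (card (P \<inter> C) * p) dvd card (P \<inter> C) * order G"
      using card_times_card_set_centralizer_dvd[OF PG] unfolding C_def by (meson dvd_refl dvd_trans mult_dvd_mono)
    then have "card (P \<inter> C) * (p * card P) dvd card (P \<inter> C) * order G"
      by (simp add: ac_simps)
    then have "p * card P dvd order G"
      using fC(2) by simp
    then show False using prime_times_card_sylow_not_dvd[OF fin p P] by blast
  qed
qed

section \<open>The number of elements in classes of size prime to \<open>p\<close>\<close>

theorem theorem3p1:
  fixes G (structure) and p :: nat and P :: "'a set"
  assumes "group G" and "finite (carrier G)"
    and "Factorial_Ring.prime p"
    and "sylow_subgroup p P G"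
  shows "card (center G) dvd card (p'_class_union p G) \<and>
         (p_part p (card (p'_class_union p G)) = p_part p (card (center G)) \<longleftrightarrow>
          commutator_subgroup G (center (G\<lparr>carrier := P\<rparr>)) (carrier G) = {\<one>})"
proof -
  interpret group G by fact
  note fin = assms(2) and p = assms(3) and P = assms(4)
  have PG: "subgroup P G" and cP: "card P = p ^ multiplicity p (order G)"
    using P by (simp_all add: sylow_subgroup_def p_part_def)
  define S where "S = p'_class_union p G"
  define C where "C = set_centralizer G P"
  define Z where "Z = center G"
  have C: "subgroup C G"
    unfolding C_def using PG by (intro subgroup_set_centralizer subgroup.subset)
  have Z: "subgroup Z G" by (simp add: Z_def subgroup_center)
  have ZC: "Z \<subseteq> C"
    using subgroup.mem_carrier[OF PG] by (auto simp: Z_def C_def center_def set_centralizer_def)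
  have Z0: "card Z > 0"
    by (rule subgroup.finite_imp_card_positive[OF Z fin])
  have C0: "card C > 0"
    by (rule subgroup.finite_imp_card_positive[OF C fin])
  obtain k where k: "card C = card Z * k"
    using card_subgroup_dvd[OF Z C ZC] by auto
  obtain m where m: "card (S - C) = p * card Z * m"
    using prime_times_card_center_dvd_card_diff[OF fin p PG cP] by (auto simp: S_def C_def Z_def)
  have CS: "C \<subseteq> S"
    using set_centralizer_sylow_subset[OF fin p P] by (simp add: C_def S_def)
  have "finite S"
    using fin by (rule finite_subset[rotated]) (auto simp: S_def p'_class_union_eq[OF fin p])
  then have "card S = card C + card (S - C)"
    using CS by (metis add.commute card_Diff_subset card_mono finite_subset le_add_diff_inverse2)
  then have S: "card S = card Z * (k + p * m)"
    using k m by (simp add: algebra_simps)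
  have "k \<noteq> 0" using k C0 by auto
  then have "multiplicity p (card S) = multiplicity p (card Z) + multiplicity p (k + p * m)"
    unfolding S using p Z0 by (intro prime_elem_multiplicity_mult_distrib) auto
  then have "p_part p (card S) = p_part p (card Z) \<longleftrightarrow> multiplicity p (k + p * m) = 0"
    using prime_gt_1_nat[OF p] by (simp add: p_part_def power_inject_exp)
  also have "\<dots> \<longleftrightarrow> \<not> p dvd k + p * m"
    using multiplicity_eq_zero_iff[of "k + p * m" p] \<open>k \<noteq> 0\<close> prime_gt_1_nat[OF p] by auto
  also have "\<dots> \<longleftrightarrow> \<not> p dvd k"
    using dvd_add_left_iff[of p "p * m" k] by simp
  also have "\<dots> \<longleftrightarrow> center (G\<lparr>carrier := P\<rparr>) \<subseteq> center G"
    using sylow_center_central_iff[OF fin p P, of k] k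
    by (simp add: C_def Z_def center_restrict_carrier[OF subgroup.subset[OF PG]])
  also have "\<dots> \<longleftrightarrow> commutator_subgroup G (center (G\<lparr>carrier := P\<rparr>)) (carrier G) = {\<one>}"
  proof (rule commutator_subgroup_carrier_trivial_iff[symmetric])
    show "center (G\<lparr>carrier := P\<rparr>) \<subseteq> carrier G"
      using subgroup.subset[OF PG] by (auto simp: center_def)
  qed
  finally show ?thesis
    using S by (simp add: S_def Z_def)
qed

end
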